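(* Let $V_1, V_2$ be positive integers and let $(V_m)_{m\ge 1}$ satisfy $V_m=V_{m-1}+V_{m-2}$ for $m\ge 3$. Let $n$ be a positive integer and $d$ an odd positive integer, and suppose $\gcd(V_1,V_2)=1$ and $\gcd(V_n,F_d)=1$. If $S=\langle V_n,V_{n+d},V_{n+2d},\ldots\rangle$, then: (i) $\mathbf{e}(S)=2$; (ii) $\mathbf{F}(S)=(V_n-1)(V_{n+d}-1)-1$; (iii) $\mathbf{g}(S)=\frac12 (V_n-1)(V_{n+d}-1)$; (iv) $\mathrm{PF}(S)=\{(V_n-1)(V_{n+d}-1)-1\}$.
   Context: For a set $A$ of positive integers, $\langle A\rangle$ denotes the set of all finite linear combinations of elements of $A$ with non-negative integer coefficients; if $\gcd(A)=1$ then $S=\langle A\rangle$ is a numerical semigroup and $\mathbb{Z}_{\ge 0}\setminus S$ is finite. The embedding dimension $\mathbf{e}(S)$ is the size of the minimal set of generators of $S$, i.e. of $S^{\star}\setminus(S^{\star}+S^{\star})$ where $S^{\star}=S\setminus\{0\}$. The Frobenius number $\mathbf{F}(S)$ is the largest element of $\mathbb{Z}_{\ge 0}\setminus S$. The genus $\mathbf{g}(S)$ is the cardinality of $\mathbb{Z}_{\ge 0}\setminus S$. $\mathrm{PF}(S)$ is the set of pseudo-Frobenius numbers in the standard sense: integers $x\notin S$ such that $x+s\in S$ for all $s\in S\setminus\{0\}$. $F_m$ denotes the Fibonacci sequence: $F_0=0$, $F_1=F_2=1$, $F_m=F_{m-1}+F_{m-2}$.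
   Formalization: Part (i) is stated only when V_n ≠ 1 and V_{n+d} ≠ 1, since otherwise S is all non-negative integers and e(S)=1 (e.g. V_1=V_2=1, n=d=1); in that case F(S), otherwise undefined, is taken to be −1. *)

theory Defs
  imports Complex_Main "HOL-Number_Theory.Fib"
begin

definition nonneg_span :: "nat set \<Rightarrow> nat set" where
  "nonneg_span A = {\<Sum>a\<in>B. c a * a | B c. finite B \<and> B \<subseteq> A}"

definition minimal_generators :: "nat set \<Rightarrow> nat set" where
  "minimal_generators S = (S - {0}) - {x + y | x y. x \<in> S - {0} \<and> y \<in> S - {0}}"

definition embedding_dim :: "nat set \<Rightarrow> nat" where
  "embedding_dim S = card (minimal_generators S)"

definition gaps :: "nat set \<Rightarrow> nat set" where
  "gaps S = UNIV - S"

text \<open>The semigroup of all non-negative integers has no gaps; its Frobenius number is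
  \<open>-1\<close> by the usual convention (the largest integer not in the semigroup).\<close>

definition frobenius_number :: "nat set \<Rightarrow> int" where
  "frobenius_number S = (if gaps S = {} then -1 else int (Max (gaps S)))"

definition genus :: "nat set \<Rightarrow> nat" where
  "genus S = card (gaps S)"

text \<open>Pseudo-Frobenius numbers range over all integers: \<open>-1\<close> is one when there are no gaps.\<close>

definition pseudo_frobenius :: "nat set \<Rightarrow> int set" where
  "pseudo_frobenius S = {x. x \<notin> int ` S \<and> (\<forall>s\<in>S - {0}. x + int s \<in> int ` S)}"

end

theory Submission
  imports Defs
begin

text \<open>
  Since \<open>d\<close> is odd, Cassini's identity gives
  \<open>V (m + 2 * d) = (fib (d - 1) + fib (d + 1)) * V (m + d) + V m\<close>, so \<open>S\<close> is generated by
  \<open>a = V n\<close> and \<open>b = V (n + d)\<close>, which are coprime. Every integer is uniquely \<open>u * a + v * b\<close>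
  with \<open>0 \<le> u < b\<close>, and it lies in \<open>S\<close> iff \<open>v \<ge> 0\<close>. Hence \<open>S\<close> is symmetric: exactly one of
  \<open>x\<close> and \<open>N - x\<close> lies in \<open>S\<close>, where \<open>N = a * b - a - b\<close>. The Frobenius number, the genus and the
  pseudo-Frobenius numbers can be read off from this symmetry.
\<close>

section \<open>Symmetric semigroups\<close>

text \<open>Letting \<open>z\<close> range over all integers makes the symmetry axiom put every
  integer above \<open>N\<close> into \<open>S\<close>, since \<open>N - z\<close> is then negative.
  It also covers \<open>S = UNIV\<close>, where \<open>N = -1\<close>.\<close>

locale symmetric_semigroup =
  fixes S :: "nat set" and N :: int
  assumes zero_mem: "0 \<in> S"
    and add_mem: "x \<in> S \<Longrightarrow> y \<in> S \<Longrightarrow> x + y \<in> S"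
    and symmetric: "z \<in> int ` S \<longleftrightarrow> N - z \<notin> int ` S"
begin

lemma N_notin: "N \<notin> int ` S"
  using symmetric[of N] zero_mem by force

lemma greater_N_mem: "x > N \<Longrightarrow> x \<in> int ` S"
  using symmetric[of x] by auto

lemma N_ge: "N \<ge> -1"
  using greater_N_mem[of "-1"] by force

lemma gap_le: "x \<in> gaps S \<Longrightarrow> int x \<le> N"
  using greater_N_mem[of "int x"] by (force simp: gaps_def)

lemma finite_gaps: "finite (gaps S)"
  by (rule finite_subset[of _ "{..nat N}"]) (use gap_le in fastforce)+

lemma frobenius_number_eq: "frobenius_number S = N"
proof (cases "gaps S = {}")
  case True
  then have "S = UNIV" by (auto simp: gaps_def)
  \<comment> \<open>Together with \<open>N_ge\<close> this gives \<open>N = -1\<close>, the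
    conventional Frobenius number when there are no gaps.\<close>
  then have "N < 0" using N_notin by (metis nonneg_int_cases not_less rangeI)
  then show ?thesis using True N_ge by (simp add: frobenius_number_def)
next
  case False
  then have "N \<ge> 0" using gap_le by fastforce
  then have "nat N \<in> gaps S" using N_notin by (force simp: gaps_def)
  then have "Max (gaps S) = nat N"
    using gap_le finite_gaps by (intro Max_eqI) fastforce+
  then show ?thesis using False \<open>N \<ge> 0\<close> by (simp add: frobenius_number_def)
qed

text \<open>Reflection in \<open>N\<close> exchanges gaps and elements of \<open>S\<close> between 0
  and \<open>N\<close>, so exactly half of these \<open>N + 1\<close> numbers are gaps.\<close>

lemma genus_eq: "2 * int (genus S) = N + 1"
proof -
  \<comment> \<open>Using \<open>N + 1\<close> instead of \<open>N\<close> keeps the bound natural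
    even for \<open>N = -1\<close>; for \<open>x < M\<close> the reflection \<open>N - x\<close>
    becomes \<open>M - Suc x\<close> without truncation.\<close>
  define M where "M = nat (N + 1)"
  have M: "int M = N + 1" using N_ge by (simp add: M_def)
  have gaps: "gaps S = {..<M} - S"
    using gap_le M by (fastforce simp: gaps_def)
  have refl: "M - Suc x \<in> S \<longleftrightarrow> x \<notin> S" if "x < M" for x
  proof -
    have "int (M - Suc x) = N - int x" using that M by (simp add: of_nat_diff)
    then show ?thesis using symmetric[of "int x"] by (metis image_iff of_nat_eq_iff)
  qed
  have "bij_betw (\<lambda>x. M - Suc x) ({..<M} - S) ({..<M} \<inter> S)"
    by (rule bij_betw_byWitness[where f' = "\<lambda>x. M - Suc x"]) (use refl in fastforce)+
  then have "card ({..<M} - S) = card ({..<M} \<inter> S)" by (rule bij_betw_same_card)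
  moreover have "card {..<M} = card ({..<M} \<inter> S) + card ({..<M} - S)"
    by (metis card_Int_Diff finite_lessThan)
  ultimately show ?thesis using M by (simp add: genus_def gaps)
qed

text \<open>If \<open>x\<close> is pseudo-Frobenius, then \<open>N - x\<close> lies in
  \<open>S\<close> by symmetry; were it nonzero, adding it to \<open>x\<close> would put
  \<open>N\<close> into \<open>S\<close>. Conversely, \<open>N + s\<close> exceeds \<open>N\<close>
  for every nonzero \<open>s\<close> in \<open>S\<close>.\<close>

lemma pseudo_frobenius_eq: "pseudo_frobenius S = {N}"
proof (intro equalityI subsetI)
  fix x assume x: "x \<in> pseudo_frobenius S"
  then have "N - x \<in> int ` S"
    using symmetric[of x] by (auto simp: pseudo_frobenius_def)
  then obtain s where s: "s \<in> S" "int s = N - x" by force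
  have "s = 0"
  proof (rule ccontr)
    assume "s \<noteq> 0"
    then have "x + int s \<in> int ` S" using x s(1) unfolding pseudo_frobenius_def by blast
    also have "x + int s = N" using s(2) by simp
    finally show False using N_notin by contradiction
  qed
  then show "x \<in> {N}" using s by simp
next
  fix x assume "x \<in> {N}"
  then show "x \<in> pseudo_frobenius S"
    using N_notin greater_N_mem by (simp add: pseudo_frobenius_def)
qed

end

section \<open>Semigroups with two generators\<close>

lemma nonneg_span_least:
  assumes "A \<subseteq> T" "0 \<in> T" and add: "\<And>x y. x \<in> T \<Longrightarrow> y \<in> T \<Longrightarrow> x + y \<in> T"
  shows "nonneg_span A \<subseteq> T"
proof -
  have mult: "k * x \<in> T" if "x \<in> T" for k x
    by (induction k) (use that assms in auto)
  have "(\<Sum>a\<in>B. c a * a) \<in> T" if "finite B" "B \<subseteq> A" for B c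
    using that by (induction B) (use assms mult in auto)
  then show ?thesis by (auto simp: nonneg_span_def)
qed

lemma two_generated_subset_nonneg_span:
  assumes "a \<in> A" "b \<in> A"
  shows "i * a + j * b \<in> nonneg_span A"
\<comment> \<open>The span sums over a set with one coefficient per element, so equal generators
  need their coefficients merged.\<close>
proof (cases "a = b")
  case True
  then show ?thesis using assms unfolding nonneg_span_def
    by (intro CollectI exI[of _ "{a}"] exI[of _ "\<lambda>_. i + j"]) (auto simp: algebra_simps)
next
  case False
  then show ?thesis using assms unfolding nonneg_span_def
    by (intro CollectI exI[of _ "{a, b}"] exI[of _ "\<lambda>x. if x = a then i else j"]) auto
qed

definition two_generated :: "nat \<Rightarrow> nat \<Rightarrow> nat set" where
  "two_generated a b = {i * a + j * b | i j. True}"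

lemma two_generated_generators: "a \<in> two_generated a b" "b \<in> two_generated a b"
  unfolding two_generated_def by (force intro: exI[of _ 0] exI[of _ 1])+

lemma two_generated_zero: "0 \<in> two_generated a b"
  unfolding two_generated_def by force

lemma two_generated_add:
  assumes "x \<in> two_generated a b" "y \<in> two_generated a b"
  shows "x + y \<in> two_generated a b"
proof -
  from assms obtain i j k l where "x = i * a + j * b" "y = k * a + l * b"
    by (auto simp: two_generated_def)
  then have "x + y = (i + k) * a + (j + l) * b" by (simp add: algebra_simps)
  then show ?thesis unfolding two_generated_def by blast
qed

text \<open>Multiply a Bezout identity by \<open>x\<close>, reduce the coefficient of
  \<open>a\<close> modulo \<open>b\<close>, and move the quotient into the coefficient of
  \<open>b\<close>.\<close>

lemma two_generated_normal_form:
  fixes x :: int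
  assumes "coprime a b" "b > 0"
  obtains u v where "x = u * int a + v * int b" "0 \<le> u" "u < int b"
proof -
  obtain s t where st: "s * int a + t * int b = 1"
    using assms(1) bezout_int[of "int a" "int b"] by auto
  let ?u = "(x * s) mod int b"
  have "x = ?u * int a + ((x * s) div int b * int a + x * t) * int b"
  proof -
    have "x = x * (s * int a + t * int b)" using st by simp
    also have "\<dots> = (x * s) * int a + x * t * int b" by (simp add: algebra_simps)
    also have "x * s = ?u + (x * s) div int b * int b" by simp
    finally show ?thesis by (simp only: algebra_simps)
  qed
  moreover have "0 \<le> ?u" "?u < int b" using assms(2) by simp_all
  ultimately show ?thesis by (rule that)
qed

text \<open>Comparing with a non-negative representation \<open>i * a + j * b\<close>, coprimality
  makes \<open>i - u\<close> a multiple \<open>b * q\<close>. Since \<open>i\<close> is non-negative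
  and \<open>u < b\<close>, also \<open>q \<ge> 0\<close>, hence \<open>v = j + q * a\<close> is
  non-negative.\<close>

lemma normal_form_mem_two_generated_iff:
  assumes "coprime a b" "0 \<le> u" "u < int b"
  shows "u * int a + v * int b \<in> int ` two_generated a b \<longleftrightarrow> v \<ge> 0"
proof
  assume "v \<ge> 0"
  then have "u * int a + v * int b = int (nat u * a + nat v * b)" using assms by simp
  then show "u * int a + v * int b \<in> int ` two_generated a b"
    unfolding two_generated_def by blast
next
  assume "u * int a + v * int b \<in> int ` two_generated a b"
  then obtain i j where "u * int a + v * int b = int (i * a + j * b)"
    by (auto simp: two_generated_def)
  then have eq: "(int i - u) * int a = (v - int j) * int b" by (simp add: algebra_simps)
  then have "int b dvd (int i - u) * int a" by simp
  then have "int b dvd int i - u"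
    using assms(1) by (simp add: coprime_dvd_mult_left_iff coprime_commute)
  then obtain q where q: "int i - u = int b * q" by blast
  have "q \<ge> 0"
  proof (rule ccontr)
    assume "\<not> q \<ge> 0"
    then have "int b * q \<le> int b * (-1)" by (intro mult_left_mono) auto
    then show False using q assms by simp
  qed
  have "int b * (q * int a) = int b * (v - int j)" using eq q by (simp add: algebra_simps)
  then have "v - int j = q * int a" using assms by auto
  moreover have "q * int a \<ge> 0" using \<open>q \<ge> 0\<close> by simp
  ultimately show "v \<ge> 0" by linarith
qed

lemma symmetric_semigroup_two_generated:
  assumes "coprime a b" "b > 0"
  shows "symmetric_semigroup (two_generated a b) ((int a - 1) * (int b - 1) - 1)"
proof
  fix x :: int
  obtain u v where x: "x = u * int a + v * int b" and u: "0 \<le> u" "u < int b"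
    using two_generated_normal_form[OF assms] .
  \<comment> \<open>This is again a normal form: \<open>b - 1 - u\<close> stays in the range from 0
    to \<open>b - 1\<close>, while exactly one of \<open>v\<close> and \<open>- 1 - v\<close> is
    non-negative.\<close>
  have "(int a - 1) * (int b - 1) - 1 - x = (int b - 1 - u) * int a + (- 1 - v) * int b"
    by (simp add: x algebra_simps)
  then show "x \<in> int ` two_generated a b \<longleftrightarrow>
      (int a - 1) * (int b - 1) - 1 - x \<notin> int ` two_generated a b"
    using normal_form_mem_two_generated_iff[OF assms(1) u, of v]
      normal_form_mem_two_generated_iff[OF assms(1), of "int b - 1 - u" "- 1 - v"] u
    by (auto simp: x)
qed (simp_all add: two_generated_zero two_generated_add)

text \<open>Splitting off one generator shows that an irreducible element must be a generator, as
  the remainder \<open>y\<close> has to vanish.\<close>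

lemma two_generated_nonzero_cases:
  assumes "x \<in> two_generated a b" "x \<noteq> 0"
  obtains y where "y \<in> two_generated a b" "x = a + y"
  | y where "y \<in> two_generated a b" "x = b + y"
proof -
  obtain i j where x: "x = i * a + j * b" using assms(1) by (auto simp: two_generated_def)
  then consider i' where "i = Suc i'" | j' where "j = Suc j'"
    using assms(2) by (cases i; cases j) auto
  then show thesis
  proof cases
    case 1
    then show thesis using x by (intro that(1)[of "i' * a + j * b"]) (auto simp: two_generated_def)
  next
    case 2
    then show thesis using x by (intro that(2)[of "i * a + j' * b"]) (auto simp: two_generated_def)
  qed
qed

lemma two_generated_commute: "two_generated a b = two_generated b a"
  by (auto simp: two_generated_def) (metis add.commute)+

text \<open>Elements below \<open>a\<close> cannot involve \<open>a\<close>, so they are multiples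
  of \<open>b\<close>. A decomposition of \<open>a\<close> into two nonzero elements would thus make
  \<open>b\<close> divide \<open>a\<close>.\<close>

lemma generator_in_minimal_generators:
  assumes "a > 0" "\<not> b dvd a"
  shows "a \<in> minimal_generators (two_generated a b)"
proof -
  have mult: "b dvd y" if "y \<in> two_generated a b" "y < a" for y
  proof -
    from that obtain i j where "y = i * a + j * b" by (auto simp: two_generated_def)
    then show ?thesis using that(2) by (cases i) auto
  qed
  have False if "x \<in> two_generated a b - {0}" "y \<in> two_generated a b - {0}" "a = x + y" for x y
  proof -
    have "b dvd x" "b dvd y" using mult that by auto
    then show False using assms(2) that(3) by simp
  qed
  then show ?thesis
    using assms(1) two_generated_generators(1) unfolding minimal_generators_def by blast
qed

lemma minimal_generators_two_generated:
  assumes "a > 0" "b > 0" "\<not> b dvd a" "\<not> a dvd b"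
  shows "minimal_generators (two_generated a b) = {a, b}"
proof (intro equalityI subsetI)
  fix x assume x: "x \<in> minimal_generators (two_generated a b)"
  let ?S = "two_generated a b"
  from x have "x \<in> ?S" "x \<noteq> 0"
    and irred: "\<And>y z. y \<in> ?S \<Longrightarrow> z \<in> ?S \<Longrightarrow> y \<noteq> 0 \<Longrightarrow> z \<noteq> 0 \<Longrightarrow> x \<noteq> y + z"
    by (auto simp: minimal_generators_def)
  from \<open>x \<in> ?S\<close> \<open>x \<noteq> 0\<close> show "x \<in> {a, b}"
  proof (cases rule: two_generated_nonzero_cases)
    case (1 y)
    then have "y = 0" using irred[of a y] assms(1) two_generated_generators(1) by auto
    then show ?thesis using 1 by simp
  next
    case (2 y)
    then have "y = 0" using irred[of b y] assms(2) two_generated_generators(2) by auto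
    then show ?thesis using 2 by simp
  qed
next
  fix x assume "x \<in> {a, b}"
  then show "x \<in> minimal_generators (two_generated a b)"
    using generator_in_minimal_generators[of a b] generator_in_minimal_generators[of b a] assms
    by (auto simp: two_generated_commute[of b a])
qed

text \<open>For coprime numbers, one can divide the other only if it is 1, so neither generator is
  redundant.\<close>

lemma embedding_dim_two_generated:
  assumes "coprime a b" "a > 0" "b > 0" "a \<noteq> 1" "b \<noteq> 1"
  shows "embedding_dim (two_generated a b) = 2"
proof -
  have "\<not> a dvd b" "\<not> b dvd a"
    using assms by (auto dest: coprime_absorb_left coprime_absorb_right)
  moreover from this have "a \<noteq> b" by auto
  ultimately show ?thesis
    using assms by (simp add: embedding_dim_def minimal_generators_two_generated)
qed

section \<open>Generalized Fibonacci sequences\<close>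

text \<open>The sequence starts at index 1 and \<open>V 0\<close> is arbitrary, hence the positivity
  conditions on indices below.\<close>

locale fibonacci_like =
  fixes V :: "nat \<Rightarrow> nat"
  assumes pos1: "V 1 > 0" and pos2: "V 2 > 0"
    and rec: "\<And>m. m \<ge> 3 \<Longrightarrow> V m = V (m - 1) + V (m - 2)"
begin

lemma rec_Suc: "m > 0 \<Longrightarrow> V (Suc (Suc m)) = V (Suc m) + V m"
  using rec[of "Suc (Suc m)"] by simp

lemma pos: "m > 0 \<Longrightarrow> V m > 0"
proof (induction m rule: less_induct)
  case (less m)
  show ?case
  proof (cases "m \<ge> 3")
    case True
    then show ?thesis using rec[OF True] less.IH[of "m - 1"] by simp
  next
    case False
    with less.prems have "m = 1 \<or> m = 2" by auto
    then show ?thesis using pos1 pos2 by auto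
  qed
qed

lemma coprime_consecutive:
  assumes "coprime (V 1) (V 2)" "m > 0"
  shows "coprime (V m) (V (Suc m))"
  using assms(2)
proof (induction m rule: nat_induct_non_zero)
  case 1
  then show ?case using assms(1) by (simp add: numeral_2_eq_2)
next
  case (Suc m)
  then show ?case
    by (simp add: rec_Suc coprime_iff_gcd_eq_1 gcd.commute)
qed

text \<open>Both sides satisfy the Fibonacci recurrence in \<open>k\<close>. Shifting by
  \<open>Suc k\<close> avoids truncated subtraction in the index of the second Fibonacci
  coefficient.\<close>

lemma shift: "m > 0 \<Longrightarrow> V (m + Suc k) = fib (Suc k) * V (Suc m) + fib k * V m"
proof (induction k rule: fib.induct)
  case (3 k)
  then show ?case
    using rec_Suc[of "m + Suc k"] by (simp add: algebra_simps)
qed (simp_all add: rec_Suc)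

text \<open>Modulo \<open>V m\<close>, the term \<open>V (m + d)\<close> is
  \<open>fib d * V (Suc m)\<close>, and both factors are coprime to \<open>V m\<close>.\<close>

lemma coprime_shift:
  assumes "coprime (V 1) (V 2)" "coprime (V m) (fib d)" "m > 0" "d > 0"
  shows "coprime (V m) (V (m + d))"
proof -
  obtain k where d: "d = Suc k" using assms(4) by (cases d) auto
  have "gcd (V m) (V (m + d)) = gcd (V m) (fib d * V (Suc m))"
    using shift[OF assms(3), of k] by (simp add: d gcd_add_mult add.commute mult.commute)
  also have "\<dots> = 1"
    using assms coprime_consecutive[of m] by (simp add: coprime_iff_gcd_eq_1[symmetric])
  finally show ?thesis by (simp add: coprime_iff_gcd_eq_1)
qed

text \<open>The coefficient \<open>fib (d - 1) + fib (d + 1)\<close> is the Lucas number of index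
  \<open>d\<close>. Oddness of \<open>d\<close> gives \<open>V m\<close> the positive sign that a
  non-negative combination requires.\<close>

lemma double_shift:
  assumes "odd d" "m > 0"
  shows "V (m + 2 * d) = (fib (d - 1) + fib (d + 1)) * V (m + d) + V m"
proof -
  obtain k where d: "d = Suc k" using assms(1) by (cases d) auto
  \<comment> \<open>Here \<open>k\<close> is even, which fixes the sign; positivity of
    \<open>fib (Suc k)\<close> undoes the truncated subtraction in
    \<open>fib_Cassini_nat\<close>.\<close>
  have cassini: "fib (Suc k) * fib (Suc k) = fib (Suc (Suc k)) * fib k + 1"
    using fib_Cassini_nat[of k] fib_neq_0_nat[of "Suc k"] assms(1)
    by (simp add: d power2_eq_square del: fib.simps)
  have 1: "V (m + d) = fib (Suc k) * V (Suc m) + fib k * V m"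
    using shift[OF assms(2), of k] by (simp add: d)
  have 2: "V (Suc (m + d)) = fib (Suc (Suc k)) * V (Suc m) + fib (Suc k) * V m"
    using shift[OF assms(2), of "Suc k"] by (simp add: d)
  have "V (m + 2 * d) = fib (Suc k) * V (Suc (m + d)) + fib k * V (m + d)"
    using shift[of "m + d" k] assms(2) by (simp add: d mult_2 add.assoc)
  \<comment> \<open>Cassini rewrites the square in front of \<open>V m\<close>: one part completes
    \<open>V (m + d)\<close> with factor \<open>fib (Suc (Suc k))\<close>, and the remaining 1
    leaves \<open>V m\<close>.\<close>
  also have "fib (Suc k) * V (Suc (m + d)) = fib (Suc (Suc k)) * V (m + d) + V m"
  proof -
    have "fib (Suc k) * V (Suc (m + d)) =
        fib (Suc (Suc k)) * fib (Suc k) * V (Suc m) + (fib (Suc k) * fib (Suc k)) * V m"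
      unfolding 2 by (simp only: algebra_simps)
    then show ?thesis unfolding cassini 1 by (simp only: algebra_simps mult_1)
  qed
  finally show ?thesis by (simp add: d algebra_simps)
qed

lemma nonneg_span_progression:
  assumes "odd d" "m > 0"
  shows "nonneg_span (range (\<lambda>k. V (m + k * d))) = two_generated (V m) (V (m + d))"
proof (rule equalityI)
  let ?T = "two_generated (V m) (V (m + d))"
  have mult: "c * x \<in> ?T" if "x \<in> ?T" for c x
    by (induction c) (use that two_generated_zero two_generated_add in auto)
  \<comment> \<open>The recurrence with step \<open>d\<close> has order two, so the induction
    carries two successive terms.\<close>
  have "V (m + k * d) \<in> ?T \<and> V (m + Suc k * d) \<in> ?T" for k
  proof (induction k)
    case 0
    then show ?case using two_generated_generators by simp
  next
    case (Suc k)
    have "m + Suc (Suc k) * d = m + k * d + 2 * d" "m + Suc k * d = m + k * d + d"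
      by simp_all
    then have "V (m + Suc (Suc k) * d) =
        (fib (d - 1) + fib (d + 1)) * V (m + Suc k * d) + V (m + k * d)"
      using double_shift[OF assms(1), of "m + k * d"] assms(2) by (simp only: add_pos_nonneg zero_le)
    then show ?case using Suc mult two_generated_add by metis
  qed
  then show "nonneg_span (range (\<lambda>k. V (m + k * d))) \<subseteq> ?T"
    by (intro nonneg_span_least) (auto intro: two_generated_zero two_generated_add)
next
  have "V m \<in> range (\<lambda>k. V (m + k * d))" "V (m + d) \<in> range (\<lambda>k. V (m + k * d))"
    by (auto intro: range_eqI[of _ _ 0] range_eqI[of _ _ 1])
  then show "two_generated (V m) (V (m + d)) \<subseteq> nonneg_span (range (\<lambda>k. V (m + k * d)))"
    using two_generated_subset_nonneg_span by (auto simp: two_generated_def)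
qed

end

text \<open>If one of the two generators is 1, then \<open>S\<close> is all of the naturals and has
  embedding dimension 1, so that claim carries a condition. The other formulas cover this case too,
  with Frobenius number -1 and genus 0.\<close>

theorem theorem3p2:
  fixes V :: "nat \<Rightarrow> nat" and n d :: nat and S :: "nat set"
  assumes "V 1 > 0" and "V 2 > 0"
    and "\<And>m. m \<ge> 3 \<Longrightarrow> V m = V (m - 1) + V (m - 2)"
    and "n > 0" and "d > 0" and "odd d"
    and "gcd (V 1) (V 2) = 1"
    and "gcd (V n) (fib d) = 1"
    and "S = nonneg_span (range (\<lambda>k. V (n + k * d)))"
  shows "(V n \<noteq> 1 \<and> V (n + d) \<noteq> 1 \<longrightarrow> embedding_dim S = 2)
    \<and> frobenius_number S = (int (V n) - 1) * (int (V (n + d)) - 1) - 1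
    \<and> real (genus S) = 1 / 2 * ((real (V n) - 1) * (real (V (n + d)) - 1))
    \<and> pseudo_frobenius S = {(int (V n) - 1) * (int (V (n + d)) - 1) - 1}"
proof -
  interpret fibonacci_like V using assms(1-3) by unfold_locales
  have S: "S = two_generated (V n) (V (n + d))"
    using nonneg_span_progression assms by simp
  have coprime: "coprime (V n) (V (n + d))"
    using coprime_shift assms by (simp add: coprime_iff_gcd_eq_1)
  have pos: "V n > 0" "V (n + d) > 0" using pos assms(4) by simp_all
  interpret symmetric_semigroup S "(int (V n) - 1) * (int (V (n + d)) - 1) - 1"
    unfolding S using symmetric_semigroup_two_generated coprime pos(2) .
  have "2 * int (genus S) = (int (V n) - 1) * (int (V (n + d)) - 1)"
    using genus_eq by simp
  then have "real_of_int (2 * int (genus S)) =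
      real_of_int ((int (V n) - 1) * (int (V (n + d)) - 1))" by (simp only:)
  then have "real (genus S) = 1 / 2 * ((real (V n) - 1) * (real (V (n + d)) - 1))" by simp
  then show ?thesis
    using embedding_dim_two_generated[OF coprime pos] frobenius_number_eq pseudo_frobenius_eq
    by (simp add: S)
qed

end
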